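(* Let $1\le p<\infty$, $\lambda\in(0,n)$ and $f\in\mathcal M_{\sqrt{\triangle},p}$. Then $f\in \mathrm{L}^{p,\lambda}(\mathbb R^n)$ if and only if $$\Big(\sup_{(x,t)\in\mathbb R^{n+1}_+}t^{n-\lambda}\,e^{-t\sqrt{\triangle}}\big(|f-e^{-t\sqrt{\triangle}}f(x)|^p\big)(x)\Big)^{1/p}<\infty ,$$ where, for each fixed $(x,t)$, $e^{-t\sqrt{\triangle}}\big(|f-e^{-t\sqrt{\triangle}}f(x)|^p\big)(x)=\int_{\mathbb R^n}p_t(x-y)\,\big|f(y)-e^{-t\sqrt{\triangle}}f(x)\big|^p\,dy$.
   Context: $\triangle=-\sum_{i=1}^n\partial_{x_i}^2$ is the Laplacian and $e^{-t\sqrt{\triangle}}$ is the Poisson semigroup, acting by $e^{-t\sqrt{\triangle}}f(x)=\int_{\mathbb R^n}p_t(x-y)f(y)\,dy$, $t>0$, with $p_t(x-y)=\dfrac{c_nt}{(t^2+|x-y|^2)^{(n+1)/2}}$ and $c_n=\Gamma\big(\frac{n+1}{2}\big)\pi^{-\frac{n+1}{2}}$. $\mathbb R^{n+1}_+=\mathbb R^n\times(0,\infty)$. $\mathcal M_{\sqrt{\triangle},p}=\{f\in \mathrm{L}^p_{\rm loc}(\mathbb R^n):|f(x)|^p(1+|x|^{n+1})^{-1}\in \mathrm{L}^1(\mathbb R^n)\}$ (complex-valued functions). The Morrey space $\mathrm{L}^{p,\lambda}(\mathbb R^n)$ consists of all complex-valued $f\in \mathrm{L}^p_{\rm loc}(\mathbb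 R^n)$ with $$\|f\|_{\mathrm{L}^{p,\lambda}}=\sup_{B\subset\mathbb R^n}\Big[r_B^{-\lambda}\int_B|f(x)-f_B|^pdx\Big]^{1/p}<\infty,$$ where the supremum is over all Euclidean open balls $B$ with radius $r_B$ and $f_B=|B|^{-1}\int_Bf(x)\,dx$. *)

theory Defs
  imports "HOL-Analysis.Analysis"
begin

text \<open>
  Throughout, the underlying space is \<open>real^'n\<close>, of dimension \<open>CARD('n)\<close>, with its Lebesgue
  measure.  Elements of the function spaces are Lebesgue measurable functions, not classes modulo
  null sets; every notion below is invariant under modification on a null set.
  Suprema and integrals of nonnegative functions are taken in \<^typ>\<open>ennreal\<close>, so that
  ``finite'' means \<open>< \<infinity>\<close> and no divergent integral is silently replaced by 0.
\<close>

text \<open>The power of an extended nonnegative number, for exponents \<open>q > 0\<close> (so \<open>\<infinity>\<^sup>q = \<infinity>\<close>).\<close>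
definition ennreal_powr :: "ennreal \<Rightarrow> real \<Rightarrow> ennreal" where
  "ennreal_powr a q = (if a = \<infinity> then \<infinity> else ennreal (enn2real a powr q))"

definition Lp_loc :: "real \<Rightarrow> (real^'n \<Rightarrow> complex) set" where
  "Lp_loc p = {f. f \<in> borel_measurable lebesgue \<and>
     (\<forall>K. compact K \<longrightarrow> set_integrable lebesgue K (\<lambda>x. cmod (f x) powr p))}"

definition M_sqrt_lap :: "real \<Rightarrow> (real^'n \<Rightarrow> complex) set" where
  "M_sqrt_lap p = {f \<in> Lp_loc p.
     integrable lebesgue (\<lambda>x. cmod (f x) powr p * inverse (1 + norm x ^ (CARD('n) + 1)))}"

definition poisson_kernel :: "real \<Rightarrow> real^'n \<Rightarrow> real" where
  "poisson_kernel t x =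
     Gamma ((real CARD('n) + 1) / 2) * pi powr (- ((real CARD('n) + 1) / 2)) * t
       / (t\<^sup>2 + (norm x)\<^sup>2) powr ((real CARD('n) + 1) / 2)"

definition poisson :: "real \<Rightarrow> (real^'n \<Rightarrow> complex) \<Rightarrow> real^'n \<Rightarrow> complex" where
  "poisson t f x = (LINT y|lebesgue. poisson_kernel t (x - y) *\<^sub>R f y)"

text \<open>The Poisson semigroup on nonnegative functions, where the integral may be infinite.\<close>
definition poisson_nn :: "real \<Rightarrow> (real^'n \<Rightarrow> real) \<Rightarrow> real^'n \<Rightarrow> ennreal" where
  "poisson_nn t g x = (\<integral>\<^sup>+ y. ennreal (poisson_kernel t (x - y) * g y) \<partial>lebesgue)"

definition ball_average :: "(real^'n \<Rightarrow> complex) \<Rightarrow> real^'n \<Rightarrow> real \<Rightarrow> complex" where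
  "ball_average f a r = (LINT y:ball a r|lebesgue. f y) /\<^sub>R measure lebesgue (ball a r)"

definition morrey_norm :: "real \<Rightarrow> real \<Rightarrow> (real^'n \<Rightarrow> complex) \<Rightarrow> ennreal" where
  "morrey_norm p l f =
     (SUP (a, r) \<in> UNIV \<times> {0<..}.
        ennreal_powr
          (ennreal (r powr (- l)) *
            (\<integral>\<^sup>+ x \<in> ball a r. ennreal (cmod (f x - ball_average f a r) powr p) \<partial>lebesgue))
          (1 / p))"

definition morrey_space :: "real \<Rightarrow> real \<Rightarrow> (real^'n \<Rightarrow> complex) set" where
  "morrey_space p l = {f \<in> Lp_loc p. morrey_norm p l f < \<infinity>}"

end

theory Submission
  imports Defs "HOL-Probability.Distributions"
begin

text \<open>
  Both conditions say that the weighted mean oscillation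
  \<open>\<integral> w |f - \<integral> w f|\<^sup>p\<close> at scale \<open>t\<close> is at most \<open>(D t\<^sup>-\<^sup>\<beta>)\<^sup>p\<close> with \<open>\<beta> = (n - \<lambda>) / p\<close>, where
  \<open>w\<close> is either the normalised indicator of the ball \<open>B(x, t)\<close> or the Poisson kernel
  \<open>p\<^sub>t(x - \<cdot>)\<close>.  Both are probability densities, so replacing the mean of \<open>f\<close> by any other
  constant changes the oscillation only by a constant factor.  The first weight is dominated by a
  multiple of the second, which gives one direction.  Conversely the Poisson kernel is dominated by
  a multiple of \<open>\<Sum>k. 2\<^sup>-\<^sup>k w\<^sub>k\<close>, with \<open>w\<^sub>k\<close> the weight of \<open>B(x, 2\<^sup>k t)\<close>, and the averages of \<open>f\<close>
  over these balls differ from the one over \<open>B(x, t)\<close> by \<open>O(t\<^sup>-\<^sup>\<beta>)\<close>, because the differences of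
  consecutive averages decay geometrically (this uses \<open>\<lambda> < n\<close>).  The Poisson kernel is normalised
  by writing it as a superposition of Gaussians.
\<close>

section \<open>Elementary inequalities for real powers\<close>

lemma powr_add_le_2powr:
  fixes a b q :: real
  assumes "0 \<le> a" "0 \<le> b" "0 \<le> q"
  shows "(a + b) powr q \<le> 2 powr q * (a powr q + b powr q)"
proof -
  have "(a + b) powr q \<le> (2 * max a b) powr q"
    using assms by (intro powr_mono2) auto
  also have "\<dots> = 2 powr q * max a b powr q"
    using assms by (subst powr_mult) auto
  also have "\<dots> \<le> 2 powr q * (a powr q + b powr q)"
    by (intro mult_left_mono) (auto simp: max_def)
  finally show ?thesis .
qed

text \<open>For \<open>c \<ge> 1\<close> and \<open>p \<ge> 1\<close> one has
  \<open>c \<le> c powr p\<close>. This moves constants inside the power, so that all later bounds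
  keep the shape \<open>(D * t powr - \<beta>) powr p\<close>.\<close>

lemma mult_powr_le_powr:
  fixes a c p :: real
  assumes "1 \<le> c" "1 \<le> p" "0 \<le> a"
  shows "c * a powr p \<le> (c * a) powr p"
  using assms powr_mono[of 1 p c] by (simp add: powr_mult mult_right_mono)

section \<open>Means and oscillations with respect to a probability density\<close>

locale probability_weight =
  fixes M :: "'a measure" and w :: "'a \<Rightarrow> real"
  assumes borel_measurable_weight [measurable]: "w \<in> borel_measurable M"
    and weight_nonneg [simp]: "0 \<le> w y"
    and nn_integral_weight: "(\<integral>\<^sup>+ y. ennreal (w y) \<partial>M) = 1"
begin

lemma nn_integral_weight_mult:
  "0 \<le> c \<Longrightarrow> (\<integral>\<^sup>+ y. ennreal (w y * c) \<partial>M) = ennreal c"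
  by (simp add: ennreal_mult nn_integral_multc nn_integral_weight)

text \<open>A substitute for Jensen's inequality, up to the factor 2, from
  \<open>z \<le> m + m\<^sup>1\<^sup>-\<^sup>p z\<^sup>p\<close>.\<close>
lemma norm_mean_minus_le:
  fixes g :: "'a \<Rightarrow> complex"
  assumes [measurable]: "g \<in> borel_measurable M"
    and p: "1 \<le> p" and m: "0 < m"
    and bound: "(\<integral>\<^sup>+ y. ennreal (w y * cmod (g y - c) powr p) \<partial>M) \<le> ennreal (m powr p)"
  shows "cmod ((LINT y|M. w y *\<^sub>R g y) - c) \<le> 2 * m"
proof -
  have le: "z \<le> m + m powr (1 - p) * z powr p" if "0 \<le> z" for z :: real
  proof (cases "z \<le> m")
    case False
    then have z: "z = z powr (1 - p) * z powr p"
      using m by (simp flip: powr_add)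
    have "z powr (1 - p) \<le> m powr (1 - p)"
      using False m p by (intro powr_mono2') auto
    then have "z powr (1 - p) * z powr p \<le> m powr (1 - p) * z powr p"
      by (intro mult_right_mono) auto
    with z m show ?thesis by linarith
  qed (simp add: add_increasing2)
  have "(\<integral>\<^sup>+ y. ennreal (norm (w y *\<^sub>R (g y - c))) \<partial>M)
      \<le> (\<integral>\<^sup>+ y. ennreal (w y * m) +
            ennreal (m powr (1 - p)) * ennreal (w y * cmod (g y - c) powr p) \<partial>M)"
  proof (intro nn_integral_mono)
    fix y
    have "w y * cmod (g y - c) \<le> w y * (m + m powr (1 - p) * cmod (g y - c) powr p)"
      by (intro mult_left_mono le) auto
    also have "\<dots> = w y * m + m powr (1 - p) * (w y * cmod (g y - c) powr p)"
      by (simp add: algebra_simps)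
    finally show "ennreal (norm (w y *\<^sub>R (g y - c))) \<le> ennreal (w y * m) +
        ennreal (m powr (1 - p)) * ennreal (w y * cmod (g y - c) powr p)"
      using m by (simp flip: ennreal_mult ennreal_plus)
  qed
  also have "\<dots> = ennreal m +
      ennreal (m powr (1 - p)) * (\<integral>\<^sup>+ y. ennreal (w y * cmod (g y - c) powr p) \<partial>M)"
    using m by (subst nn_integral_add) (auto simp: nn_integral_cmult nn_integral_weight_mult)
  also have "\<dots> \<le> ennreal m + ennreal (m powr (1 - p)) * ennreal (m powr p)"
    by (intro add_left_mono mult_left_mono bound) auto
  also have "\<dots> = ennreal (2 * m)"
    using m by (simp flip: ennreal_mult ennreal_plus powr_add)
  finally have bnd: "(\<integral>\<^sup>+ y. ennreal (norm (w y *\<^sub>R (g y - c))) \<partial>M) \<le> ennreal (2 * m)" .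
  \<comment> \<open>The finite bound makes \<open>w (g - c)\<close> integrable, and
    \<open>w c\<close> is integrable too. Hence the mean of \<open>g\<close> is a genuine integral
    and not the default value 0.\<close>
  have int: "integrable M (\<lambda>y. w y *\<^sub>R (g y - c))"
    by (rule integrableI_bounded) (use le_less_trans[OF bnd] in auto)
  have w: "integrable M w" "integral\<^sup>L M w = 1"
    using nn_integral_weight
    by (auto intro!: integrableI_bounded simp: integral_eq_nn_integral)
  have "(LINT y|M. w y *\<^sub>R g y) = (LINT y|M. w y *\<^sub>R (g y - c) + w y *\<^sub>R c)"
    by (simp add: scaleR_diff_right)
  also have "\<dots> = (LINT y|M. w y *\<^sub>R (g y - c)) + c"
    using w by (subst Bochner_Integration.integral_add[OF int]) auto
  finally have "ennreal (cmod ((LINT y|M. w y *\<^sub>R g y) - c)) \<le> ennreal (2 * m)"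
    using integral_norm_bound_ennreal[OF int] bnd by (simp add: order_trans)
  then show ?thesis
    using m by (simp add: ennreal_le_iff)
qed

text \<open>Triangle inequality before taking powers. The 4 is a product of two factors 2: one from
  the power of the sum \<open>|g - c| + \<delta>\<close>, the other from \<open>m^p + \<delta>^p
  \<le> 2 (m + \<delta>)^p \<le> (2 (m + \<delta>))^p\<close>.\<close>

lemma nn_integral_shift_le:
  fixes g :: "'a \<Rightarrow> complex"
  assumes [measurable]: "g \<in> borel_measurable M"
    and p: "1 \<le> p" and d: "cmod (c - d) \<le> \<delta>" and "0 \<le> m"
    and bound: "(\<integral>\<^sup>+ y. ennreal (w y * cmod (g y - c) powr p) \<partial>M) \<le> ennreal (m powr p)"
  shows "(\<integral>\<^sup>+ y. ennreal (w y * cmod (g y - d) powr p) \<partial>M) \<le> ennreal ((4 * (m + \<delta>)) powr p)"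
proof -
  have \<delta>: "0 \<le> \<delta>"
    using d norm_ge_zero order_trans by blast
  have "(\<integral>\<^sup>+ y. ennreal (w y * cmod (g y - d) powr p) \<partial>M)
      \<le> (\<integral>\<^sup>+ y. ennreal (2 powr p) * ennreal (w y * cmod (g y - c) powr p)
            + ennreal (w y * (2 powr p * \<delta> powr p)) \<partial>M)"
  proof (intro nn_integral_mono)
    fix y
    have "cmod (g y - d) \<le> cmod (g y - c) + \<delta>"
      using norm_triangle_ineq[of "g y - c" "c - d"] d by simp
    then have "cmod (g y - d) powr p \<le> (cmod (g y - c) + \<delta>) powr p"
      using p by (intro powr_mono2) auto
    also have "\<dots> \<le> 2 powr p * (cmod (g y - c) powr p + \<delta> powr p)"
      using p \<delta> by (intro powr_add_le_2powr) auto
    finally have "w y * cmod (g y - d) powr p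
        \<le> w y * (2 powr p * (cmod (g y - c) powr p + \<delta> powr p))"
      by (intro mult_left_mono) auto
    then show "ennreal (w y * cmod (g y - d) powr p)
        \<le> ennreal (2 powr p) * ennreal (w y * cmod (g y - c) powr p)
            + ennreal (w y * (2 powr p * \<delta> powr p))"
      by (simp flip: ennreal_mult ennreal_plus add: algebra_simps)
  qed
  also have "\<dots> = ennreal (2 powr p) * (\<integral>\<^sup>+ y. ennreal (w y * cmod (g y - c) powr p) \<partial>M)
      + ennreal (2 powr p * \<delta> powr p)"
    by (subst nn_integral_add) (auto simp: nn_integral_cmult nn_integral_weight_mult)
  also have "\<dots> \<le> ennreal (2 powr p) * ennreal (m powr p) + ennreal (2 powr p * \<delta> powr p)"
    by (intro add_right_mono mult_left_mono bound) auto
  also have "\<dots> = ennreal (2 powr p * (m powr p + \<delta> powr p))"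
    by (simp flip: ennreal_mult ennreal_plus add: algebra_simps)
  also have "\<dots> \<le> ennreal ((4 * (m + \<delta>)) powr p)"
  proof (intro ennreal_leI)
    have "m powr p + \<delta> powr p \<le> 2 * (m + \<delta>) powr p"
      using powr_mono2[of p m "m + \<delta>"] powr_mono2[of p \<delta> "m + \<delta>"] \<delta> \<open>0 \<le> m\<close> p by simp
    also have "\<dots> \<le> (2 * (m + \<delta>)) powr p"
      using \<delta> \<open>0 \<le> m\<close> p by (intro mult_powr_le_powr) auto
    finally have "2 powr p * (m powr p + \<delta> powr p) \<le> 2 powr p * (2 * (m + \<delta>)) powr p"
      by (intro mult_left_mono) auto
    also have "\<dots> = (4 * (m + \<delta>)) powr p"
      using \<delta> \<open>0 \<le> m\<close> by (simp flip: powr_mult)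
    finally show "2 powr p * (m powr p + \<delta> powr p) \<le> (4 * (m + \<delta>)) powr p" .
  qed
  finally show ?thesis .
qed

text \<open>The mean lies within \<open>2 * m\<close> of \<open>c\<close>, so shifting from
  \<open>c\<close> to the mean gives \<open>4 * (m + 2 * m) = 12 * m\<close>. Thus it suffices to
  control the deviation of \<open>g\<close> from any convenient constant.\<close>

lemma oscillation_le:
  fixes g :: "'a \<Rightarrow> complex"
  assumes "g \<in> borel_measurable M" "1 \<le> p" "0 < m"
    and "(\<integral>\<^sup>+ y. ennreal (w y * cmod (g y - c) powr p) \<partial>M) \<le> ennreal (m powr p)"
  shows "(\<integral>\<^sup>+ y. ennreal (w y * cmod (g y - (LINT y|M. w y *\<^sub>R g y)) powr p) \<partial>M)
    \<le> ennreal ((12 * m) powr p)"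
  using nn_integral_shift_le[OF assms(1,2) _ _ assms(4), of "LINT y|M. w y *\<^sub>R g y" "2 * m"]
    norm_mean_minus_le[OF assms] assms(3) by (simp add: norm_minus_commute)

end

section \<open>Normalisation of the Poisson kernel by Gaussian subordination\<close>

lemma nn_integral_exp_neg_square:
  fixes u x :: real
  assumes u: "0 < u"
  shows "(\<integral>\<^sup>+ s. ennreal (exp (- u * (x - s)\<^sup>2)) \<partial>lborel) = ennreal (sqrt (pi / u))"
proof -
  \<comment> \<open>With variance \<open>1 / (2 * u)\<close>, the integrand is
    \<open>sqrt (pi / u)\<close> times a normal density with mean \<open>x\<close>, which has total
    mass 1.\<close>
  define \<sigma> where "\<sigma> = sqrt (1 / (2 * u))"
  have \<sigma>: "\<sigma> > 0" "\<sigma>\<^sup>2 = 1 / (2 * u)"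
    using u by (auto simp: \<sigma>_def)
  interpret N: prob_space "density lborel (normal_density x \<sigma>)"
    using \<sigma> by (intro prob_space_normal_density) auto
  have "exp (- u * (x - s)\<^sup>2) = sqrt (pi / u) * normal_density x \<sigma> s" for s
    using u pi_gt_zero unfolding normal_density_def \<sigma>
    by (simp add: power2_commute real_sqrt_divide)
  then have "(\<integral>\<^sup>+ s. ennreal (exp (- u * (x - s)\<^sup>2)) \<partial>lborel)
      = ennreal (sqrt (pi / u)) * (\<integral>\<^sup>+ s. ennreal (normal_density x \<sigma> s) \<partial>lborel)"
    using u by (simp add: ennreal_mult nn_integral_cmult)
  also have "(\<integral>\<^sup>+ s. ennreal (normal_density x \<sigma> s) \<partial>lborel) = 1"
    using N.emeasure_space_1 by (simp add: emeasure_density)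
  finally show ?thesis by simp
qed

text \<open>The squared norm is a sum over coordinates, so the exponential and its integral factor
  into one-dimensional Gaussians.\<close>

lemma nn_integral_gaussian:
  fixes x :: "'a::euclidean_space"
  assumes u: "0 < u"
  shows "(\<integral>\<^sup>+ y. ennreal (exp (- u * (norm (x - y))\<^sup>2)) \<partial>lborel)
    = ennreal ((pi / u) powr (real DIM('a) / 2))"
proof -
  have "(norm (x - y))\<^sup>2 = (\<Sum>b\<in>Basis. (x \<bullet> b - y \<bullet> b)\<^sup>2)" for y
    unfolding power2_norm_eq_inner
    by (subst euclidean_inner) (simp add: inner_diff_left power2_eq_square)
  then have "exp (- u * (norm (x - y))\<^sup>2) = (\<Prod>b\<in>Basis. exp (- u * (x \<bullet> b - y \<bullet> b)\<^sup>2))" for y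
    by (simp add: sum_distrib_left exp_sum flip: sum_negf)
  then have "(\<integral>\<^sup>+ y. ennreal (exp (- u * (norm (x - y))\<^sup>2)) \<partial>lborel)
      = (\<integral>\<^sup>+ y. (\<Prod>b\<in>Basis. ennreal (exp (- u * (x \<bullet> b - y \<bullet> b)\<^sup>2))) \<partial>lborel)"
    by (simp add: prod_ennreal)
  also have "\<dots> = (\<Prod>b\<in>Basis. \<integral>\<^sup>+ s. ennreal (exp (- u * (x \<bullet> b - s)\<^sup>2)) \<partial>lborel)"
    by (rule nn_integral_lborel_prod) auto
  also have "\<dots> = (\<Prod>b\<in>(Basis::'a set). ennreal (sqrt (pi / u)))"
    using u by (simp only: nn_integral_exp_neg_square)
  also have "\<dots> = ennreal (sqrt (pi / u) ^ DIM('a))"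
    using u by (simp add: ennreal_power)
  also have "sqrt (pi / u) ^ DIM('a) = (pi / u) powr (real DIM('a) / 2)"
    using u by (simp add: powr_half_sqrt_powr powr_realpow real_sqrt_power)
  finally show ?thesis .
qed

text \<open>Scaling the variable by \<open>a\<close> in the Gamma integral. It is used twice: with
  \<open>a = t^2 + |x - y|^2\<close> to write the Poisson kernel as a superposition of Gaussians,
  and with \<open>a = t^2\<close>, \<open>s = 1/2\<close> to evaluate the total mass.\<close>

lemma nn_integral_powr_exp_neg:
  fixes s a :: real
  assumes s: "0 < s" and a: "0 < a"
  shows "(\<integral>\<^sup>+ u. ennreal (indicator {0<..} u * u powr (s - 1) * exp (- a * u)) \<partial>lborel)
    = ennreal (Gamma s / a powr s)"
proof -
  have "ennreal (Gamma s) = (\<integral>\<^sup>+ u. ennreal (indicator {0..} u * u powr (s - 1) / exp u) \<partial>lborel)"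
    by (rule Gamma_conv_nn_integral_real[OF s])
  also have "\<dots> = ennreal a * (\<integral>\<^sup>+ u. ennreal (indicator {0..} (a * u) * (a * u) powr (s - 1) / exp (a * u)) \<partial>lborel)"
    using a by (subst nn_integral_real_affine[where c = a and t = 0]) auto
  \<comment> \<open>The two indicators differ only at \<open>u = 0\<close>, where
    \<open>0 powr (s - 1)\<close> is 0, so the integrands agree pointwise.\<close>
  also have "\<dots> = (\<integral>\<^sup>+ u. ennreal (a powr s) *
      ennreal (indicator {0<..} u * u powr (s - 1) * exp (- a * u)) \<partial>lborel)"
    using a by (subst nn_integral_cmult[symmetric])
      (auto intro!: nn_integral_cong simp: indicator_def powr_mult exp_minus field_simps powr_diff
        zero_le_mult_iff simp flip: ennreal_mult)
  also have "\<dots> = ennreal (a powr s) *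
      (\<integral>\<^sup>+ u. ennreal (indicator {0<..} u * u powr (s - 1) * exp (- a * u)) \<partial>lborel)"
    by (subst nn_integral_cmult) auto
  finally have "ennreal (1 / a powr s) * ennreal (Gamma s) = ennreal (1 / a powr s) * (ennreal (a powr s) *
      (\<integral>\<^sup>+ u. ennreal (indicator {0<..} u * u powr (s - 1) * exp (- a * u)) \<partial>lborel))"
    by simp
  then show ?thesis
    using a s by (simp flip: mult.assoc ennreal_mult)
qed

lemma poisson_kernel_measurable [measurable]:
  "(\<lambda>y. poisson_kernel t (x - y) :: real) \<in> borel_measurable borel"
  unfolding poisson_kernel_def by measurable

lemma nn_integral_poisson_kernel:
  fixes x :: "real^'n"
  assumes t: "0 < t"
  shows "(\<integral>\<^sup>+ y. ennreal (poisson_kernel t (x - y)) \<partial>lborel) = 1"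
proof -
  define n where "n = real CARD('n)"
  define s where "s = (n + 1) / 2"
  have n: "0 < n" "0 < s"
    by (auto simp: n_def s_def)
  \<comment> \<open>Up to the factor \<open>pi powr - s * t\<close>, the kernel is the integral of
    \<open>F u y\<close> over \<open>u\<close>. After exchanging the integrals, the Gaussian in
    \<open>y\<close> contributes \<open>(pi / u) powr (n / 2)\<close>, which lowers the exponent of
    \<open>u\<close> from \<open>s - 1\<close> to \<open>-1/2\<close>; a Gamma integral at 1/2
    remains.\<close>
  define F where "F u y = indicator {0<..} u * u powr (s - 1) * exp (- (t\<^sup>2 + (norm (x - y))\<^sup>2) * u)"
    for u and y :: "real^'n"
  have [measurable]: "(\<lambda>(u, y). ennreal (F u y)) \<in> borel_measurable (lborel \<Otimes>\<^sub>M lborel)"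
    unfolding F_def by measurable
  have pos: "0 < t\<^sup>2 + (norm z)\<^sup>2" for z :: "real^'n"
    using t by (simp add: add_pos_nonneg)
  have "ennreal (poisson_kernel t (x - y))
      = ennreal (pi powr - s * t) * (\<integral>\<^sup>+ u. ennreal (F u y) \<partial>lborel)" for y
    unfolding F_def using t n Gamma_real_pos[of s]
    by (subst nn_integral_powr_exp_neg[OF n(2) pos])
      (simp add: poisson_kernel_def s_def n_def mult_ac flip: ennreal_mult)
  then have "(\<integral>\<^sup>+ y. ennreal (poisson_kernel t (x - y)) \<partial>lborel)
      = ennreal (pi powr - s * t) * (\<integral>\<^sup>+ y. \<integral>\<^sup>+ u. ennreal (F u y) \<partial>lborel \<partial>lborel)"
    by (simp add: nn_integral_cmult)
  also have "(\<integral>\<^sup>+ y. \<integral>\<^sup>+ u. ennreal (F u y) \<partial>lborel \<partial>lborel)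
      = (\<integral>\<^sup>+ u. \<integral>\<^sup>+ y. ennreal (F u y) \<partial>lborel \<partial>lborel)"
    by (rule lborel_pair.Fubini') measurable
  also have "\<dots> = (\<integral>\<^sup>+ u. ennreal (pi powr (n / 2)) *
      ennreal (indicator {0<..} u * u powr (1/2 - 1) * exp (- t\<^sup>2 * u)) \<partial>lborel)"
  proof (intro nn_integral_cong)
    fix u :: real
    show "(\<integral>\<^sup>+ y. ennreal (F u y) \<partial>lborel) = ennreal (pi powr (n / 2)) *
      ennreal (indicator {0<..} u * u powr (1/2 - 1) * exp (- t\<^sup>2 * u))"
    proof (cases "0 < u")
      case True
      have F: "F u y = u powr (s - 1) * exp (- t\<^sup>2 * u) * exp (- u * (norm (x - y))\<^sup>2)" for y
        using True by (simp add: F_def algebra_simps flip: exp_add)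
      have "(\<integral>\<^sup>+ y. ennreal (F u y) \<partial>lborel)
          = ennreal (u powr (s - 1) * exp (- t\<^sup>2 * u)) * (\<integral>\<^sup>+ y. ennreal (exp (- u * (norm (x - y))\<^sup>2)) \<partial>lborel)"
        unfolding F by (subst nn_integral_cmult[symmetric]) (auto simp: ennreal_mult)
      also have "\<dots> = ennreal (u powr (s - 1) * exp (- t\<^sup>2 * u) * (pi / u) powr (n / 2))"
        unfolding nn_integral_gaussian[OF True] n_def using True by (simp add: ennreal_mult)
      also have "u powr (s - 1) * exp (- t\<^sup>2 * u) * (pi / u) powr (n / 2)
          = pi powr (n / 2) * (u powr (s - 1 - n / 2) * exp (- t\<^sup>2 * u))"
        using True by (simp add: powr_divide powr_diff)
      also have "s - 1 - n / 2 = 1/2 - 1"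
        by (simp add: s_def field_simps)
      finally show ?thesis
        using True by (simp add: ennreal_mult)
    qed (simp add: F_def)
  qed
  also have "\<dots> = ennreal (pi powr (n / 2)) *
      (\<integral>\<^sup>+ u. ennreal (indicator {0<..} u * u powr (1/2 - 1) * exp (- t\<^sup>2 * u)) \<partial>lborel)"
    by (subst nn_integral_cmult) auto
  also have "\<dots> = ennreal (pi powr (n / 2)) * ennreal (sqrt pi / t)"
    using t by (subst nn_integral_powr_exp_neg) (auto simp: Gamma_one_half_real powr_half_sqrt)
  also have "ennreal (pi powr - s * t) * \<dots> = ennreal (pi powr - s * pi powr (n / 2) * pi powr (1/2))"
    using t by (simp add: powr_half_sqrt flip: ennreal_mult)
  also have "pi powr - s * pi powr (n / 2) * pi powr (1/2) = pi powr (- s + n / 2 + 1/2)"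
    by (simp only: powr_add)
  also have "- s + n / 2 + 1/2 = 0"
    by (simp add: s_def field_simps)
  finally show ?thesis by simp
qed

lemma probability_weight_poisson_kernel:
  fixes x :: "real^'n"
  assumes "0 < t"
  shows "probability_weight lebesgue (\<lambda>y. poisson_kernel t (x - y))"
proof
  show "(\<lambda>y. poisson_kernel t (x - y)) \<in> borel_measurable lebesgue"
    by (rule measurable_completion) simp
  show "0 \<le> poisson_kernel t (x - y)" for y
    using assms Gamma_real_pos[of "(real CARD('n) + 1) / 2"] by (simp add: poisson_kernel_def)
  show "(\<integral>\<^sup>+ y. ennreal (poisson_kernel t (x - y)) \<partial>lebesgue) = 1"
    using assms by (simp add: nn_integral_completion nn_integral_poisson_kernel)
qed

section \<open>Normalised indicators of balls\<close>

definition ball_weight :: "real^'n \<Rightarrow> real \<Rightarrow> real^'n \<Rightarrow> real" where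
  "ball_weight a r y = indicator (ball a r) y / (measure lborel (ball (0 :: real^'n) 1) * r ^ CARD('n))"

text \<open>Scaling of volume. It justifies the explicit power of \<open>r\<close> in
  \<open>ball_weight\<close>, which lets weights of different radii be compared by algebra.\<close>

lemma measure_lebesgue_ball:
  "0 \<le> r \<Longrightarrow> measure lebesgue (ball (a :: real^'n) r) = measure lborel (ball (0 :: real^'n) 1) * r ^ CARD('n)"
  by (simp add: content_ball_conv_unit_ball[of r a])

lemma measure_unit_ball_pos: "0 < measure lborel (ball (0 :: real^'n) 1)"
  by (rule content_ball_pos) simp

lemma ball_weight_nonneg: "0 \<le> r \<Longrightarrow> 0 \<le> ball_weight a r y"
  by (simp add: ball_weight_def)

lemma probability_weight_ball:
  fixes a :: "real^'n"
  assumes "0 < r"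
  shows "probability_weight lebesgue (ball_weight a r)"
proof
  let ?V = "measure lebesgue (ball a r)"
  have V: "0 < ?V"
    using assms by (simp add: content_ball_pos)
  have w: "ball_weight a r y = indicator (ball a r) y / ?V" for y
    unfolding ball_weight_def measure_lebesgue_ball[OF less_imp_le[OF assms]] ..
  have [measurable]: "ball a r \<in> sets lebesgue"
    by simp
  show "ball_weight a r \<in> borel_measurable lebesgue"
    unfolding w[abs_def] by measurable
  show "0 \<le> ball_weight a r y" for y
    using assms by (simp add: ball_weight_nonneg)
  have "(\<integral>\<^sup>+ y. ennreal (ball_weight a r y) \<partial>lebesgue)
      = (\<integral>\<^sup>+ y. ennreal (1 / ?V) * indicator (ball a r) y \<partial>lebesgue)"
    by (intro nn_integral_cong) (auto simp: w indicator_def)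
  also have "\<dots> = ennreal (1 / ?V) * emeasure lebesgue (ball a r)"
    by (rule nn_integral_cmult_indicator) measurable
  also have "emeasure lebesgue (ball a r) = ennreal ?V"
    using emeasure_lborel_ball_finite[of a r] by (intro emeasure_eq_ennreal_measure) auto
  also have "ennreal (1 / ?V) * ennreal ?V = 1"
    using V by (simp flip: ennreal_mult)
  finally show "(\<integral>\<^sup>+ y. ennreal (ball_weight a r y) \<partial>lebesgue) = 1" .
qed

lemma ball_average_eq_weighted:
  fixes f :: "real^'n \<Rightarrow> complex"
  assumes "0 < r"
  shows "ball_average f a r = (LINT y|lebesgue. ball_weight a r y *\<^sub>R f y)"
proof -
  let ?V = "measure lebesgue (ball a r)"
  have "(LINT y|lebesgue. ball_weight a r y *\<^sub>R f y)
      = (LINT y|lebesgue. (1 / ?V) *\<^sub>R (indicator (ball a r) y *\<^sub>R f y))"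
    unfolding ball_weight_def measure_lebesgue_ball[OF less_imp_le[OF assms]]
    by (simp add: divide_inverse mult.commute)
  also have "\<dots> = ball_average f a r"
    unfolding integral_scaleR_right
    by (simp add: ball_average_def set_lebesgue_integral_def divide_inverse)
  finally show ?thesis ..
qed

section \<open>Pointwise comparison of the Poisson kernel with ball weights\<close>

lemma square_powr_half:
  fixes R :: real
  assumes "0 < R"
  shows "(R\<^sup>2) powr ((real n + 1) / 2) = R ^ (n + 1)"
proof -
  have half: "2 * ((real n + 1) / 2) = real (n + 1)"
    by simp
  have "(R\<^sup>2) powr ((real n + 1) / 2) = (R powr 2) powr ((real n + 1) / 2)"
    using assms by simp
  also have "\<dots> = R powr real (n + 1)"
    by (simp only: powr_powr half)
  also have "\<dots> = R ^ (n + 1)"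
    using assms by (rule powr_realpow)
  finally show ?thesis .
qed

text \<open>Monotonicity in the denominator: a number \<open>R\<close> below or above the square
  root of \<open>t^2 + |z|^2\<close> takes its place, and the real power becomes
  \<open>R ^ (n + 1)\<close>. The constant \<open>c\<close> is the normalising factor of the kernel;
  only its positivity is kept.\<close>

lemma poisson_kernel_bounds:
  obtains c where "0 < c"
    "\<And>t R (z :: real^'n). \<lbrakk>0 \<le> t; 0 < R; R\<^sup>2 \<le> t\<^sup>2 + (norm z)\<^sup>2\<rbrakk>
      \<Longrightarrow> poisson_kernel t z \<le> c * t / R ^ (CARD('n) + 1)"
    "\<And>t R (z :: real^'n). \<lbrakk>0 < t; 0 < R; t\<^sup>2 + (norm z)\<^sup>2 \<le> R\<^sup>2\<rbrakk>
      \<Longrightarrow> c * t / R ^ (CARD('n) + 1) \<le> poisson_kernel t z"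
proof
  let ?s = "(real CARD('n) + 1) / 2"
  define c where "c = Gamma ?s * pi powr (- ?s)"
  show c: "0 < c"
    unfolding c_def using Gamma_real_pos[of ?s] by simp
  have eq: "poisson_kernel t z = c * t / (t\<^sup>2 + (norm z)\<^sup>2) powr ?s" for t and z :: "real^'n"
    by (simp add: poisson_kernel_def c_def)
  show "poisson_kernel t z \<le> c * t / R ^ (CARD('n) + 1)"
    if "0 \<le> t" "0 < R" "R\<^sup>2 \<le> t\<^sup>2 + (norm z)\<^sup>2" for t R and z :: "real^'n"
  proof -
    have pos: "0 < t\<^sup>2 + (norm z)\<^sup>2"
      using that by (meson less_le_trans zero_less_power)
    have "R ^ (CARD('n) + 1) = (R\<^sup>2) powr ?s"
      using that by (simp only: square_powr_half)
    also have "\<dots> \<le> (t\<^sup>2 + (norm z)\<^sup>2) powr ?s"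
      using that by (intro powr_mono2) auto
    finally show ?thesis
      unfolding eq using that c pos by (intro divide_left_mono mult_pos_pos) auto
  qed
  show "c * t / R ^ (CARD('n) + 1) \<le> poisson_kernel t z"
    if "0 < t" "0 < R" "t\<^sup>2 + (norm z)\<^sup>2 \<le> R\<^sup>2" for t R and z :: "real^'n"
  proof -
    have pos: "0 < t\<^sup>2 + (norm z)\<^sup>2"
      using that by (simp add: add_pos_nonneg)
    have "(t\<^sup>2 + (norm z)\<^sup>2) powr ?s \<le> (R\<^sup>2) powr ?s"
      using that by (intro powr_mono2) auto
    also have "\<dots> = R ^ (CARD('n) + 1)"
      using that by (simp only: square_powr_half)
    finally show ?thesis
      unfolding eq using that c pos by (intro divide_left_mono mult_pos_pos) auto
  qed
qed

text \<open>On the ball, \<open>t^2 + |x - y|^2 \<le> (2 t)^2\<close>, so there the kernel is at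
  least a constant times \<open>t / (2 t) ^ (n + 1)\<close>, which has the order
  \<open>1 / t ^ n\<close> of the weight.\<close>

lemma ball_weight_le_poisson_kernel:
  obtains C where "1 \<le> C"
    "\<And>x t (y :: real^'n). 0 < t \<Longrightarrow> ball_weight x t y \<le> C * poisson_kernel t (x - y)"
proof -
  obtain c where c: "0 < c" and ge: "\<And>t R (z :: real^'n). \<lbrakk>0 < t; 0 < R; t\<^sup>2 + (norm z)\<^sup>2 \<le> R\<^sup>2\<rbrakk>
      \<Longrightarrow> c * t / R ^ (CARD('n) + 1) \<le> poisson_kernel t z"
    by (rule poisson_kernel_bounds[where 'n = 'n]) blast
  let ?v = "measure lborel (ball (0 :: real^'n) 1)"
  define K where "K = 2 ^ (CARD('n) + 1) / (c * ?v)"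
  have v: "0 < ?v" by (rule measure_unit_ball_pos)
  show thesis
  proof
    \<comment> \<open>\<open>K\<close> turns the lower bound of the kernel exactly into the height
      of the weight. The maximum with 1 makes the constant eligible for being moved inside a
      power.\<close>
    show "1 \<le> max 1 K" by simp
    fix x y :: "real^'n" and t :: real
    assume t: "0 < t"
    have nonneg: "0 \<le> poisson_kernel t (x - y)"
      using probability_weight.weight_nonneg[OF probability_weight_poisson_kernel[OF t]] .
    have "ball_weight x t y \<le> K * poisson_kernel t (x - y)"
    proof (cases "y \<in> ball x t")
      case True
      then have "(norm (x - y))\<^sup>2 \<le> t\<^sup>2"
        by (intro power_mono) (auto simp: dist_norm)
      moreover have "(2 * t)\<^sup>2 = 4 * t\<^sup>2" by simp
      ultimately have "t\<^sup>2 + (norm (x - y))\<^sup>2 \<le> (2 * t)\<^sup>2"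
        using zero_le_power2[of t] by linarith
      then have "c * t / (2 * t) ^ (CARD('n) + 1) \<le> poisson_kernel t (x - y)"
        using t by (intro ge) auto
      then have "K * (c * t / (2 * t) ^ (CARD('n) + 1)) \<le> K * poisson_kernel t (x - y)"
        using c v by (intro mult_left_mono) (auto simp: K_def)
      moreover have "K * (c * t / (2 * t) ^ (CARD('n) + 1)) = ball_weight x t y"
      proof -
        have "X / (c * ?v) * (c * t / (X * (t * T))) = 1 / (?v * T)"
          if "0 < X" "0 < T" for X T :: real
          using that t c v by (simp add: field_simps)
        from this[of "2 ^ (CARD('n) + 1)" "t ^ CARD('n)"] show ?thesis
          using True t by (simp add: K_def ball_weight_def power_mult_distrib)
      qed
      ultimately show ?thesis by simp
    next
      case False
      have "0 \<le> K" using c v by (simp add: K_def)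
      then show ?thesis
        using False nonneg by (simp add: ball_weight_def)
    qed
    also have "\<dots> \<le> max 1 K * poisson_kernel t (x - y)"
      using nonneg by (intro mult_right_mono) auto
    finally show "ball_weight x t y \<le> max 1 K * poisson_kernel t (x - y)" .
  qed
qed

text \<open>For the least \<open>k\<close> with \<open>|x - y| < 2^k t\<close>, the square root of
  \<open>t^2 + |x - y|^2\<close> is at least \<open>2^k t / 2\<close>: if \<open>k = 0\<close>
  because of \<open>t\<close>, otherwise because \<open>|x - y| \<ge> 2^(k-1) t\<close>. The
  exponent \<open>n + 1\<close> exceeds the dimension by one, and this surplus yields the factor
  \<open>(1/2) ^ k\<close>.\<close>

lemma poisson_kernel_le_dyadic_ball_weight:
  obtains C where "0 < C"
    "\<And>x t (y :: real^'n). 0 < t \<Longrightarrow>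
      \<exists>k. poisson_kernel t (x - y) \<le> C * ((1/2) ^ k * ball_weight x (2 ^ k * t) y)"
proof -
  obtain c where c: "0 < c" and le: "\<And>t R (z :: real^'n). \<lbrakk>0 \<le> t; 0 < R; R\<^sup>2 \<le> t\<^sup>2 + (norm z)\<^sup>2\<rbrakk>
      \<Longrightarrow> poisson_kernel t z \<le> c * t / R ^ (CARD('n) + 1)"
    by (rule poisson_kernel_bounds[where 'n = 'n]) blast
  let ?v = "measure lborel (ball (0 :: real^'n) 1)"
  have v: "0 < ?v" by (rule measure_unit_ball_pos)
  define C where "C = c * ?v * 2 ^ (CARD('n) + 1)"
  show thesis
  proof
    show "0 < C" using c v by (simp add: C_def)
    fix x y :: "real^'n" and t :: real
    assume t: "0 < t"
    define k where "k = (LEAST k. norm (x - y) < 2 ^ k * t)"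
    obtain j where "norm (x - y) / t < 2 ^ j"
      using real_arch_pow[of 2] by auto
    then have "norm (x - y) < 2 ^ j * t"
      using t by (simp add: field_simps)
    then have k: "norm (x - y) < 2 ^ k * t"
      unfolding k_def by (rule LeastI)
    have "(2 ^ k * t / 2)\<^sup>2 \<le> t\<^sup>2 + (norm (x - y))\<^sup>2"
    proof (cases k)
      case 0
      have "(t / 2)\<^sup>2 \<le> t\<^sup>2"
        using t by (intro power_mono) auto
      then show ?thesis using 0 by (simp add: add_increasing2)
    next
      case (Suc j)
      have "\<not> norm (x - y) < 2 ^ j * t"
        using not_less_Least[of j "\<lambda>k. norm (x - y) < 2 ^ k * t"] Suc by (simp add: k_def)
      then have "(2 ^ j * t)\<^sup>2 \<le> (norm (x - y))\<^sup>2"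
        using t by (intro power_mono) auto
      then show ?thesis using Suc by (simp add: add_increasing)
    qed
    then have "poisson_kernel t (x - y) \<le> c * t / (2 ^ k * t / 2) ^ (CARD('n) + 1)"
      using t by (intro le) auto
    also have "\<dots> = C * ((1/2) ^ k * ball_weight x (2 ^ k * t) y)"
    proof -
      let ?R = "2 ^ k * t"
      have "c * t / (R * T / X) = c * ?v * X * (t / R * (1 / (?v * T)))"
        if "0 < R" "0 < T" "0 < X" for R T X :: real
        using that v by (simp add: field_simps)
      from this[of ?R "?R ^ CARD('n)" "2 ^ (CARD('n) + 1)"]
      have "c * t / (?R / 2) ^ (CARD('n) + 1) = C * (t / ?R * (1 / (?v * ?R ^ CARD('n))))"
        using t by (simp add: C_def power_divide)
      moreover have "t / ?R = (1/2) ^ k"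
        using t by (simp add: power_one_over)
      moreover have "ball_weight x ?R y = 1 / (?v * ?R ^ CARD('n))"
        using k by (simp add: ball_weight_def dist_norm)
      ultimately show ?thesis by simp
    qed
    finally show "\<exists>k. poisson_kernel t (x - y) \<le> C * ((1/2) ^ k * ball_weight x (2 ^ k * t) y)" ..
  qed
qed

section \<open>Transfer of oscillation bounds between the two families of weights\<close>

lemma nn_integral_dominated_weight_le:
  fixes g :: "'a \<Rightarrow> complex"
  assumes dom: "\<And>y. w y \<le> C * w' y"
    and [measurable]: "w' \<in> borel_measurable M" "g \<in> borel_measurable M"
    and "1 \<le> C" "1 \<le> p" "0 \<le> m"
    and bound: "(\<integral>\<^sup>+ y. ennreal (w' y * cmod (g y - c) powr p) \<partial>M) \<le> ennreal (m powr p)"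
  shows "(\<integral>\<^sup>+ y. ennreal (w y * cmod (g y - c) powr p) \<partial>M) \<le> ennreal ((C * m) powr p)"
proof -
  have "(\<integral>\<^sup>+ y. ennreal (w y * cmod (g y - c) powr p) \<partial>M)
      \<le> (\<integral>\<^sup>+ y. ennreal C * ennreal (w' y * cmod (g y - c) powr p) \<partial>M)"
  proof (intro nn_integral_mono)
    fix y
    have "w y * cmod (g y - c) powr p \<le> C * w' y * cmod (g y - c) powr p"
      by (intro mult_right_mono dom) auto
    then show "ennreal (w y * cmod (g y - c) powr p)
        \<le> ennreal C * ennreal (w' y * cmod (g y - c) powr p)"
      using \<open>1 \<le> C\<close> by (simp add: ennreal_mult'[symmetric] ennreal_leI mult.assoc)
  qed
  also have "\<dots> = ennreal C * (\<integral>\<^sup>+ y. ennreal (w' y * cmod (g y - c) powr p) \<partial>M)"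
    by (rule nn_integral_cmult) measurable
  also have "\<dots> \<le> ennreal C * ennreal (m powr p)"
    by (intro mult_left_mono bound) auto
  also have "\<dots> \<le> ennreal ((C * m) powr p)"
    using assms mult_powr_le_powr[of C p m] by (simp add: ennreal_mult'[symmetric] ennreal_leI)
  finally show ?thesis .
qed

text \<open>The common form of both conditions, with \<open>w x t\<close> the weight centred at
  \<open>x\<close> at scale \<open>t\<close>. Since \<open>D > 0\<close>, the bound has the strict
  positivity that \<open>oscillation_le\<close> asks of \<open>m\<close>.\<close>

abbreviation oscillation_bounded ::
  "real \<Rightarrow> real \<Rightarrow> (real^'n \<Rightarrow> complex) \<Rightarrow> (real^'n \<Rightarrow> real \<Rightarrow> real^'n \<Rightarrow> real) \<Rightarrow> bool" where
  "oscillation_bounded p \<beta> f w \<equiv> \<exists>D>0. \<forall>x t. 0 < t \<longrightarrow>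
     (\<integral>\<^sup>+ y. ennreal (w x t y * cmod (f y - (LINT z|lebesgue. w x t z *\<^sub>R f z)) powr p) \<partial>lebesgue)
       \<le> ennreal ((D * t powr - \<beta>) powr p)"

text \<open>By domination, \<open>f\<close> deviates little from its Poisson mean on the ball as
  well; \<open>oscillation_le\<close> then replaces that constant by the ball average, at the cost
  of the factor 12.\<close>

lemma oscillation_bounded_ball_if_poisson:
  fixes f :: "real^'n \<Rightarrow> complex"
  assumes f: "f \<in> borel_measurable lebesgue" and p: "1 \<le> p"
    and "oscillation_bounded p \<beta> f (\<lambda>x t y. poisson_kernel t (x - y))"
  shows "oscillation_bounded p \<beta> f ball_weight"
proof -
  obtain D where D: "0 < D" and bound: "\<And>x t. 0 < t \<Longrightarrow>
     (\<integral>\<^sup>+ y. ennreal (poisson_kernel t (x - y) *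
       cmod (f y - (LINT z|lebesgue. poisson_kernel t (x - z) *\<^sub>R f z)) powr p) \<partial>lebesgue)
       \<le> ennreal ((D * t powr - \<beta>) powr p)"
    using assms(3) by blast
  obtain C where C: "1 \<le> C"
    and dom: "\<And>x t (y :: real^'n). 0 < t \<Longrightarrow> ball_weight x t y \<le> C * poisson_kernel t (x - y)"
    by (rule ball_weight_le_poisson_kernel[where 'n = 'n]) blast
  show ?thesis
  proof (intro exI[of _ "12 * (C * D)"] conjI allI impI)
    show "0 < 12 * (C * D)" using C D by simp
    fix x :: "real^'n" and t :: real
    assume t: "0 < t"
    interpret B: probability_weight lebesgue "ball_weight x t"
      using t by (rule probability_weight_ball)
    interpret P: probability_weight lebesgue "\<lambda>y. poisson_kernel t (x - y)"
      using t by (rule probability_weight_poisson_kernel)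
    show "(\<integral>\<^sup>+ y. ennreal (ball_weight x t y *
        cmod (f y - (LINT z|lebesgue. ball_weight x t z *\<^sub>R f z)) powr p) \<partial>lebesgue)
      \<le> ennreal ((12 * (C * D) * t powr - \<beta>) powr p)"
      using B.oscillation_le[OF f p _ nn_integral_dominated_weight_le[OF
            dom[OF t] P.borel_measurable_weight f C p _ bound[OF t]]] C D t
      by (simp add: mult.assoc)
  qed
qed

lemma ball_weight_le_double:
  "0 < r \<Longrightarrow> ball_weight a r y \<le> 2 ^ CARD('n) * ball_weight (a :: real^'n) (2 * r) y"
  using measure_unit_ball_pos[where 'n = 'n]
  by (auto simp: ball_weight_def indicator_def power_mult_distrib field_simps)

lemma oscillation_bounded_poisson_if_ball:
  fixes f :: "real^'n \<Rightarrow> complex"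
  assumes f [measurable]: "f \<in> borel_measurable lebesgue" and p: "1 \<le> p" and \<beta>: "0 < \<beta>"
    and "oscillation_bounded p \<beta> f ball_weight"
  shows "oscillation_bounded p \<beta> f (\<lambda>x t y. poisson_kernel t (x - y))"
proof -
  define A where "A x t = (LINT z|lebesgue. ball_weight x t z *\<^sub>R f z)" for x t
  obtain D where D: "0 < D" and bound: "\<And>x t. 0 < t \<Longrightarrow>
     (\<integral>\<^sup>+ y. ennreal (ball_weight x t y * cmod (f y - A x t) powr p) \<partial>lebesgue)
       \<le> ennreal ((D * t powr - \<beta>) powr p)"
    using assms(4) unfolding A_def by blast
  obtain C where C: "0 < C" and dom: "\<And>x t (y :: real^'n). 0 < t \<Longrightarrow>
      \<exists>k. poisson_kernel t (x - y) \<le> C * ((1/2) ^ k * ball_weight x (2 ^ k * t) y)"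
    by (rule poisson_kernel_le_dyadic_ball_weight[where 'n = 'n]) blast
  \<comment> \<open>The ratio by which the bound shrinks when the radius doubles; it is below 1
    because \<open>\<beta> > 0\<close>.\<close>
  define q where "q = 2 powr - \<beta>"
  have q: "0 < q" "q < 1"
    using \<beta> powr_less_mono[of "-\<beta>" 0 2] by (auto simp: q_def)
  have scale: "(2 ^ k * t) powr - \<beta> = q ^ k * t powr - \<beta>" if "0 < t" for k t
    using that by (simp add: q_def powr_mult powr_powr mult.commute flip: powr_realpow)
  define G where "G = 2 * (2 ^ CARD('n) * D)"
  have G: "0 < G" using D by (simp add: G_def)
  \<comment> \<open>Domination by the weight of the doubled ball costs \<open>2 ^ n\<close> and
    bounds the deviation of \<open>f\<close> from \<open>A x (2 * t)\<close> on the smaller ball;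
    passing to the mean costs the 2 in \<open>G\<close>.\<close>
  have step: "cmod (A x t - A x (2 * t)) \<le> G * (2 * t) powr - \<beta>" if t: "0 < t" for x t
  proof -
    interpret B: probability_weight lebesgue "ball_weight x t"
      using t by (rule probability_weight_ball)
    interpret B2: probability_weight lebesgue "ball_weight x (2 * t)"
      using t by (intro probability_weight_ball) simp
    have "cmod (A x t - A x (2 * t)) \<le> 2 * (2 ^ CARD('n) * (D * (2 * t) powr - \<beta>))"
      unfolding A_def[of x t] using t D
      by (intro B.norm_mean_minus_le[OF f p] nn_integral_dominated_weight_le[OF
            ball_weight_le_double[OF t] B2.borel_measurable_weight f _ p] bound) auto
    then show ?thesis by (simp add: G_def mult_ac)
  qed
  \<comment> \<open>Each difference is bounded at its larger radius, hence the exponents start at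
    1.\<close>
  have telescope: "cmod (A x (2 ^ k * t) - A x t) \<le> G * t powr - \<beta> * (\<Sum>j<k. q ^ Suc j)"
    if t: "0 < t" for x t k
  proof (induction k)
    case (Suc k)
    have "cmod (A x (2 ^ k * t) - A x (2 ^ Suc k * t)) \<le> G * (q ^ Suc k * t powr - \<beta>)"
      using step[of "2 ^ k * t" x] t scale[of t "Suc k"] by (simp add: mult.assoc)
    then have "cmod (A x (2 ^ Suc k * t) - A x t)
        \<le> G * (q ^ Suc k * t powr - \<beta>) + G * t powr - \<beta> * (\<Sum>j<k. q ^ Suc j)"
      using Suc norm_triangle_ineq[of "A x (2 ^ Suc k * t) - A x (2 ^ k * t)" "A x (2 ^ k * t) - A x t"]
      by (simp add: norm_minus_commute)
    also have "\<dots> = G * t powr - \<beta> * (\<Sum>j<Suc k. q ^ Suc j)"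
      by (simp add: algebra_simps)
    finally show ?case .
  qed simp
  define H where "H = G / (1 - q)"
  have H: "0 < H" using G q by (simp add: H_def)
  have mean_diff: "cmod (A x (2 ^ k * t) - A x t) \<le> H * t powr - \<beta>" if t: "0 < t" for x t k
  proof -
    have "(\<Sum>j<k. q ^ Suc j) \<le> (\<Sum>j<k. q ^ j)"
      using q by (intro sum_mono power_decreasing) auto
    also have "\<dots> \<le> (\<Sum>j. q ^ j)"
      using q by (intro sum_le_suminf summable_geometric) auto
    also have "\<dots> = 1 / (1 - q)"
      using q by (intro suminf_geometric) auto
    finally have "G * t powr - \<beta> * (\<Sum>j<k. q ^ Suc j) \<le> G * t powr - \<beta> * (1 / (1 - q))"
      using G by (intro mult_left_mono) auto
    with telescope[OF t, of x k] show ?thesis by (simp add: H_def mult_ac)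
  qed
  \<comment> \<open>The constant of \<open>nn_integral_shift_le\<close> when moving from the average
    over the ball of radius \<open>2^k t\<close> to \<open>A x t\<close>. One constant then serves
    all dyadic balls.\<close>
  define E where "E = 4 * (D + H)"
  have E: "0 < E" using D H by (simp add: E_def)
  have dyadic: "(\<integral>\<^sup>+ y. ennreal (ball_weight x (2 ^ k * t) y * cmod (f y - A x t) powr p) \<partial>lebesgue)
       \<le> ennreal ((E * t powr - \<beta>) powr p)" if t: "0 < t" for x t k
  proof -
    have r: "0 < 2 ^ k * t" using t by simp
    interpret B: probability_weight lebesgue "ball_weight x (2 ^ k * t)"
      using r by (rule probability_weight_ball)
    have "D * (2 ^ k * t) powr - \<beta> \<le> D * t powr - \<beta>"
      using D t \<beta> by (intro mult_left_mono powr_mono2') (auto simp: mult_le_cancel_right1)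
    then have "(D * (2 ^ k * t) powr - \<beta>) powr p \<le> (D * t powr - \<beta>) powr p"
      using D p by (intro powr_mono2) auto
    then have "(\<integral>\<^sup>+ y. ennreal (ball_weight x (2 ^ k * t) y * cmod (f y - A x (2 ^ k * t)) powr p) \<partial>lebesgue)
       \<le> ennreal ((D * t powr - \<beta>) powr p)"
      using bound[OF r, of x] by (meson ennreal_leI order_trans)
    from B.nn_integral_shift_le[OF f p mean_diff[OF t] _ this] D
    have "(\<integral>\<^sup>+ y. ennreal (ball_weight x (2 ^ k * t) y * cmod (f y - A x t) powr p) \<partial>lebesgue)
       \<le> ennreal ((4 * (D * t powr - \<beta> + H * t powr - \<beta>)) powr p)"
      by simp
    also have "4 * (D * t powr - \<beta> + H * t powr - \<beta>) = E * t powr - \<beta>"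
      by (simp add: E_def distrib_right)
    finally show ?thesis .
  qed
  \<comment> \<open>\<open>2 * C\<close> is the sum of the series \<open>C * (1/2) ^ k\<close>; the
    maximum with 1 lets it enter the power.\<close>
  define L where "L = max 1 (2 * C)"
  have poisson_bound: "(\<integral>\<^sup>+ y. ennreal (poisson_kernel t (x - y) * cmod (f y - A x t) powr p) \<partial>lebesgue)
       \<le> ennreal ((L * (E * t powr - \<beta>)) powr p)" if t: "0 < t" for x t
  proof -
    let ?h = "\<lambda>y. cmod (f y - A x t) powr p"
    let ?w = "\<lambda>k. ball_weight x (2 ^ k * t)"
    have [measurable]: "?w k \<in> borel_measurable lebesgue" for k
      using t by (intro probability_weight.borel_measurable_weight probability_weight_ball) simp
    \<comment> \<open>The suitable \<open>k\<close> varies with \<open>y\<close>. Enlarging its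
      single term to the whole series removes this dependence and allows integration term by
      term.\<close>
    have "(\<integral>\<^sup>+ y. ennreal (poisson_kernel t (x - y) * ?h y) \<partial>lebesgue)
        \<le> (\<integral>\<^sup>+ y. (\<Sum>k. ennreal (C * (1/2) ^ k) * ennreal (?w k y * ?h y)) \<partial>lebesgue)"
    proof (intro nn_integral_mono)
      fix y
      obtain k where "poisson_kernel t (x - y) \<le> C * ((1/2) ^ k * ?w k y)"
        using dom[OF t] by blast
      then have "poisson_kernel t (x - y) * ?h y \<le> C * ((1/2) ^ k * ?w k y) * ?h y"
        by (intro mult_right_mono) auto
      then have "ennreal (poisson_kernel t (x - y) * ?h y)
          \<le> ennreal (C * (1/2) ^ k) * ennreal (?w k y * ?h y)"
        using C by (simp add: ennreal_mult'[symmetric] ennreal_leI mult_ac)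
      also have "\<dots> \<le> (\<Sum>k. ennreal (C * (1/2) ^ k) * ennreal (?w k y * ?h y))"
        using sum_le_suminf[of "\<lambda>k. ennreal (C * (1/2) ^ k) * ennreal (?w k y * ?h y)" "{k}"]
        by simp
      finally show "ennreal (poisson_kernel t (x - y) * ?h y)
          \<le> (\<Sum>k. ennreal (C * (1/2) ^ k) * ennreal (?w k y * ?h y))" .
    qed
    also have "\<dots> = (\<Sum>k. ennreal (C * (1/2) ^ k) * (\<integral>\<^sup>+ y. ennreal (?w k y * ?h y) \<partial>lebesgue))"
      by (subst nn_integral_suminf) (auto simp: nn_integral_cmult)
    also have "\<dots> \<le> (\<Sum>k. ennreal (C * (1/2) ^ k) * ennreal ((E * t powr - \<beta>) powr p))"
      by (intro suminf_le mult_left_mono dyadic[OF t]) auto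
    also have "\<dots> = (\<Sum>k. ennreal (C * (E * t powr - \<beta>) powr p * (1/2) ^ k))"
      using C by (simp add: ennreal_mult'[symmetric] mult_ac)
    also have "\<dots> = ennreal (2 * C * (E * t powr - \<beta>) powr p)"
      using C sums_mult[OF geometric_sums[of "1/2 :: real"], of "C * (E * t powr - \<beta>) powr p"]
      by (intro suminf_ennreal_eq) (auto simp: mult_ac)
    also have "\<dots> \<le> ennreal (L * (E * t powr - \<beta>) powr p)"
      by (intro ennreal_leI mult_right_mono) (auto simp: L_def)
    also have "\<dots> \<le> ennreal ((L * (E * t powr - \<beta>)) powr p)"
      using E p by (intro ennreal_leI mult_powr_le_powr) (auto simp: L_def)
    finally show ?thesis .
  qed
  show ?thesis
  proof (intro exI[of _ "12 * (L * E)"] conjI allI impI)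
    have L: "0 < L" by (simp add: L_def)
    show "0 < 12 * (L * E)" using L E by simp
    fix x :: "real^'n" and t :: real
    assume t: "0 < t"
    interpret P: probability_weight lebesgue "\<lambda>y. poisson_kernel t (x - y)"
      using t by (rule probability_weight_poisson_kernel)
    show "(\<integral>\<^sup>+ y. ennreal (poisson_kernel t (x - y) *
        cmod (f y - (LINT z|lebesgue. poisson_kernel t (x - z) *\<^sub>R f z)) powr p) \<partial>lebesgue)
      \<le> ennreal ((12 * (L * E) * t powr - \<beta>) powr p)"
      using P.oscillation_le[OF f p _ poisson_bound[OF t]] L E t by (simp add: mult.assoc)
  qed
qed

section \<open>Finiteness of suprema and of the Morrey norm as uniform bounds\<close>

lemma ennreal_powr_le_iff:
  assumes "0 < q" "0 \<le> M"
  shows "ennreal_powr a (1 / q) \<le> ennreal M \<longleftrightarrow> a \<le> ennreal (M powr q)"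
proof (cases a)
  case (real r)
  have "r powr (1 / q) \<le> M \<longleftrightarrow> r \<le> M powr q"
  proof
    assume "r powr (1 / q) \<le> M"
    then have "(r powr (1 / q)) powr q \<le> M powr q"
      using assms by (intro powr_mono2) auto
    then show "r \<le> M powr q" using assms real by (simp add: powr_powr)
  next
    assume "r \<le> M powr q"
    then have "r powr (1 / q) \<le> (M powr q) powr (1 / q)"
      using assms real by (intro powr_mono2) auto
    then show "r powr (1 / q) \<le> M" using assms by (simp add: powr_powr)
  qed
  then show ?thesis
    using real assms by (simp add: ennreal_powr_def ennreal_le_iff)
next
  case top
  then show ?thesis by (simp add: ennreal_powr_def top_unique)
qed

lemma ennreal_less_top_iff_bounded:
  "(a :: ennreal) < \<infinity> \<longleftrightarrow> (\<exists>M>0. a \<le> ennreal M)"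
proof
  assume "a < \<infinity>"
  then obtain r where "0 \<le> r" "a = ennreal r"
    by (cases a) auto
  then show "\<exists>M>0. a \<le> ennreal M"
    by (intro exI[of _ "r + 1"]) (auto intro: ennreal_leI)
qed (auto intro: le_less_trans)

lemma ennreal_mult_le_iff:
  assumes "0 < s"
  shows "ennreal s * a \<le> ennreal b \<longleftrightarrow> a \<le> ennreal (b / s)"
proof (cases "0 \<le> b")
  case True
  with assms show ?thesis
    by (cases a) (auto simp: ennreal_mult'[symmetric] ennreal_le_iff field_simps ennreal_mult_top top_unique)
next
  case False
  with assms show ?thesis
    by (auto simp: ennreal_neg divide_nonpos_pos)
qed

text \<open>The Morrey norm takes the root inside the supremum, the Poisson condition outside. This
  lemma and the next reduce both to the same uniform bound.\<close>

lemma SUP_ennreal_powr_finite_iff: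
  "0 < q \<Longrightarrow> (SUP i\<in>I. ennreal_powr (X i) (1 / q)) < \<infinity> \<longleftrightarrow> (\<exists>M>0. \<forall>i\<in>I. X i \<le> ennreal (M powr q))"
  unfolding ennreal_less_top_iff_bounded by (auto simp: SUP_le_iff ennreal_powr_le_iff)

lemma ennreal_powr_SUP_finite_iff:
  "0 < q \<Longrightarrow> ennreal_powr (SUP i\<in>I. X i) (1 / q) < \<infinity> \<longleftrightarrow> (\<exists>M>0. \<forall>i\<in>I. X i \<le> ennreal (M powr q))"
  unfolding ennreal_less_top_iff_bounded by (auto simp: SUP_le_iff ennreal_powr_le_iff)

text \<open>With \<open>s = n - l\<close> this turns the prefactor \<open>t powr (n - l)\<close> of
  both conditions into the decay \<open>t powr - \<beta>\<close> inside the power.\<close>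

lemma powr_scale_eq:
  fixes M t p s :: real
  assumes "0 < p" "0 \<le> M" "0 < t"
  shows "M powr p / t powr s = (M * t powr - (s / p)) powr p"
proof -
  have "M powr p / t powr s = M powr p * t powr - s"
    by (simp add: powr_minus_divide)
  also have "t powr - s = (t powr - (s / p)) powr p"
    using assms by (simp add: powr_powr)
  finally show ?thesis
    using assms by (simp add: powr_mult)
qed

text \<open>The unnormalised integral over a ball is \<open>?v * r ^ n\<close> times the weighted
  one, so the prefactor \<open>r powr - l\<close> becomes \<open>?v * r powr (n - l)\<close>. The
  volume \<open>?v\<close> is absorbed by rescaling the constant by
  \<open>?v powr (1 / p)\<close>.\<close>

lemma morrey_norm_finite_iff:
  fixes f :: "real^'n \<Rightarrow> complex"
  assumes p: "1 \<le> p" and f [measurable]: "f \<in> borel_measurable lebesgue"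
  shows "morrey_norm p l f < \<infinity> \<longleftrightarrow>
    oscillation_bounded p ((real CARD('n) - l) / p) f ball_weight"
proof -
  let ?v = "measure lborel (ball (0 :: real^'n) 1)"
  let ?s = "real CARD('n) - l"
  let ?O = "\<lambda>a r. \<integral>\<^sup>+ y. ennreal (ball_weight a r y *
        cmod (f y - (LINT z|lebesgue. ball_weight a r z *\<^sub>R f z)) powr p) \<partial>lebesgue"
  have v: "0 < ?v" by (rule measure_unit_ball_pos)
  have scale: "ennreal (r powr (- l)) *
      (\<integral>\<^sup>+ x \<in> ball a r. ennreal (cmod (f x - ball_average f a r) powr p) \<partial>lebesgue)
      = ennreal (?v * r powr ?s) * ?O a r" if r: "0 < r" for a r
  proof -
    have [measurable]: "ball a r \<in> sets lebesgue" by simp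
    interpret B: probability_weight lebesgue "ball_weight a r"
      using r by (rule probability_weight_ball)
    have "(\<integral>\<^sup>+ x \<in> ball a r. ennreal (cmod (f x - ball_average f a r) powr p) \<partial>lebesgue)
        = (\<integral>\<^sup>+ y. ennreal (?v * r ^ CARD('n)) * ennreal (ball_weight a r y *
        cmod (f y - ball_average f a r) powr p) \<partial>lebesgue)"
      using r v by (intro nn_integral_cong)
        (auto simp: ball_weight_def indicator_def ennreal_mult'[symmetric])
    also have "\<dots> = ennreal (?v * r ^ CARD('n)) * ?O a r"
      unfolding ball_average_eq_weighted[OF r] by (rule nn_integral_cmult) measurable
    finally have "ennreal (r powr (- l)) *
        (\<integral>\<^sup>+ x \<in> ball a r. ennreal (cmod (f x - ball_average f a r) powr p) \<partial>lebesgue)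
        = ennreal (r powr (- l) * (?v * r ^ CARD('n))) * ?O a r"
      by (simp add: ennreal_mult' mult.assoc)
    also have "r powr (- l) * (?v * r ^ CARD('n)) = ?v * r powr ?s"
      using r by (simp add: powr_diff powr_minus powr_realpow divide_inverse)
    finally show ?thesis .
  qed
  have iff: "ennreal (?v * r powr ?s) * ?O a r \<le> ennreal (M powr p) \<longleftrightarrow>
      ?O a r \<le> ennreal ((M / ?v powr (1 / p) * r powr - (?s / p)) powr p)" if "0 < r" "0 < M" for a r M
  proof -
    have "(M / ?v powr (1 / p) * r powr - (?s / p)) powr p = (M / ?v powr (1 / p)) powr p / r powr ?s"
      using that v p by (intro powr_scale_eq[symmetric]) auto
    also have "(M / ?v powr (1 / p)) powr p = M powr p / ?v"
      using that v p by (simp add: powr_divide powr_powr)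
    finally show ?thesis
      using that v by (simp add: ennreal_mult_le_iff)
  qed
  have "morrey_norm p l f < \<infinity> \<longleftrightarrow> (\<exists>M>0. \<forall>a r. 0 < r \<longrightarrow>
      ?O a r \<le> ennreal ((M / ?v powr (1 / p) * r powr - (?s / p)) powr p))"
    unfolding morrey_norm_def using p
    by (subst split_def, subst SUP_ennreal_powr_finite_iff) (auto simp: scale iff)
  also have "\<dots> \<longleftrightarrow> oscillation_bounded p (?s / p) f ball_weight"
  proof safe
    fix M :: real
    assume "0 < M" "\<forall>a r. 0 < r \<longrightarrow>
      ?O a r \<le> ennreal ((M / ?v powr (1 / p) * r powr - (?s / p)) powr p)"
    then show "oscillation_bounded p (?s / p) f ball_weight"
      using v by (intro exI[of _ "M / ?v powr (1 / p)"]) auto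
  next
    fix D :: real
    assume "0 < D" "\<forall>a r. 0 < r \<longrightarrow> ?O a r \<le> ennreal ((D * r powr - (?s / p)) powr p)"
    then show "\<exists>M>0. \<forall>a r. 0 < r \<longrightarrow>
      ?O a r \<le> ennreal ((M / ?v powr (1 / p) * r powr - (?s / p)) powr p)"
      using v by (intro exI[of _ "D * ?v powr (1 / p)"]) auto
  qed
  finally show ?thesis .
qed

theorem proposition3p4:
  fixes p l :: real and f :: "real^'n \<Rightarrow> complex"
  assumes "1 \<le> p"
    and "0 < l" and "l < real CARD('n)"
    and "f \<in> M_sqrt_lap p"
  shows "f \<in> morrey_space p l \<longleftrightarrow>
    ennreal_powr
      (SUP (x, t) \<in> UNIV \<times> {0<..}.
         ennreal (t powr (real CARD('n) - l)) *
           poisson_nn t (\<lambda>y. cmod (f y - poisson t f x) powr p) x)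
      (1 / p) < \<infinity>"
proof -
  let ?\<beta> = "(real CARD('n) - l) / p"
  have f: "f \<in> Lp_loc p" "f \<in> borel_measurable lebesgue"
    using assms by (auto simp: M_sqrt_lap_def Lp_loc_def)
  have \<beta>: "0 < ?\<beta>" using assms by simp
  \<comment> \<open>Local integrability is already contained in \<open>f \<in> M_sqrt_lap p\<close>,
    so only finiteness of the norm remains.\<close>
  have "f \<in> morrey_space p l \<longleftrightarrow> oscillation_bounded p ?\<beta> f ball_weight"
    by (simp only: morrey_space_def mem_Collect_eq f morrey_norm_finite_iff[OF assms(1) f(2)] simp_thms)
  also have "\<dots> \<longleftrightarrow> oscillation_bounded p ?\<beta> f (\<lambda>x t y. poisson_kernel t (x - y))"
    using oscillation_bounded_ball_if_poisson[OF f(2) assms(1)]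
      oscillation_bounded_poisson_if_ball[OF f(2) assms(1) \<beta>] by blast
  also have "\<dots> \<longleftrightarrow> ennreal_powr
      (SUP (x, t) \<in> UNIV \<times> {0<..}.
         ennreal (t powr (real CARD('n) - l)) *
           poisson_nn t (\<lambda>y. cmod (f y - poisson t f x) powr p) x)
      (1 / p) < \<infinity>"
    using assms(1) by (subst split_def, subst ennreal_powr_SUP_finite_iff)
      (auto simp: ennreal_mult_le_iff powr_scale_eq poisson_nn_def poisson_def Ball_def)
  finally show ?thesis .
qed

end
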